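(* Let $f$ and $g$ be representable positive functionals on a complex ${}^{\ast}$-algebra $\mathscr{A}$. Then $f$ admits a decomposition $$f=f_{\ll,g}+f_{\perp,g}$$ into a sum of representable functionals, where $f_{\ll,g}$ is $g$-absolutely continuous, and $f_{\perp,g}$ and $g$ are singular. Furthermore, $f_{\ll,g}$ is the greatest among all of the representable functionals $h$ on $\mathscr{A}$ such that $h\leq f$ and $h\ll g$.
   Context: $\mathscr{A}$ is a complex ${}^{\ast}$-algebra, not assumed to be commutative or unital. A positive functional is a linear functional $f:\mathscr{A}\to\mathbb{C}$ with $f(a^{\ast}a)\geq0$ for all $a\in\mathscr{A}$. For positive functionals, $f\leq g$ means $f(a^{\ast}a)\leq g(a^{\ast}a)$ for all $a\in\mathscr{A}$, and $f$ is dominated by $g$ if $f\leq c\,g$ for some constant $c$. A positive functional $f$ is representable if there exist a Hilbert space $\mathscr{H}_f$, a ${}^{\ast}$-representation $\pi_f$ of $\mathscr{A}$ by bounded operators on $\mathscr{H}_f$, and a cyclic vector $\xi_f\in\mathscr{H}_f$ (i.e. $\{\pi_f(a)\xi_f:a\in\mathscr{A}\}$ is dense in $\mathscr{H}_f$) such that $f(a)=(\pi_f(a)\xi_f\,|\,\xi_f)_f$ for all $a\in\mathscr{A}$. $f$ is $g$-absolutely continuous ($f\ll g$) if $g(a^{\ast}a)=0$ implies $f(a^{\ast}a)=0$ for all $a\in\mathscr{A}$. Representable functionals $f$ and $g$ are singular ($f\perp g$) if the zero functional is the only representable functional dominated by both $f$ and $g$. *)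

theory Defs
  imports
    "HOL-Analysis.Analysis"
    "HOL-Library.Complex_Order"
    "HOL-Algebra.Module"
    "HOL-Decision_Procs.Algebra_Aux"
begin

locale complex_star_algebra = vector_space scl
  for scl :: "complex \<Rightarrow> 'a::ring \<Rightarrow> 'a" +
  fixes star :: "'a \<Rightarrow> 'a"
  assumes scale_mult_left: "scl c a * b = scl c (a * b)"
    and scale_mult_right: "a * scl c b = scl c (a * b)"
    and star_add: "star (a + b) = star a + star b"
    and star_scale: "star (scl c a) = scl (cnj c) (star a)"
    and star_mult: "star (a * b) = star b * star a"
    and star_star: "star (star a) = a"

text \<open>
  A Hilbert space is a carrier-based module over the field of complex numbers
  (\<open>cring_class_ops\<close>) with an inner product that is linear in the first argument.
  The components \<open>mult\<close> and \<open>one\<close> inherited from the record \<open>ring\<close> are irrelevant.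
\<close>

record 'h inner_space = "(complex, 'h) module" +
  hinner :: "'h \<Rightarrow> 'h \<Rightarrow> complex"

definition hnorm :: "('h, 'm) inner_space_scheme \<Rightarrow> 'h \<Rightarrow> real"
  where "hnorm H x = sqrt (Re (hinner H x x))"

text \<open>
  The locale \<open>Metric_space\<close> wants nonnegativity and symmetry on the whole type, hence the
  value 0 outside the carrier.
\<close>

definition hdist :: "('h, 'm) inner_space_scheme \<Rightarrow> 'h \<Rightarrow> 'h \<Rightarrow> real"
  where "hdist H x y =
    (if x \<in> carrier H \<and> y \<in> carrier H then hnorm H (x \<ominus>\<^bsub>H\<^esub> y) else 0)"

locale complex_inner_product_space = Module.module cring_class_ops H
  for H :: "('h, 'm) inner_space_scheme" (structure) +
  assumes hinner_add_left:
      "\<lbrakk>x \<in> carrier H; y \<in> carrier H; z \<in> carrier H\<rbrakk>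
        \<Longrightarrow> hinner H (x \<oplus> y) z = hinner H x z + hinner H y z"
    and hinner_smult_left:
      "\<lbrakk>x \<in> carrier H; y \<in> carrier H\<rbrakk> \<Longrightarrow> hinner H (c \<odot> x) y = c * hinner H x y"
    and hinner_commute:
      "\<lbrakk>x \<in> carrier H; y \<in> carrier H\<rbrakk> \<Longrightarrow> hinner H x y = cnj (hinner H y x)"
    and hinner_nonneg: "x \<in> carrier H \<Longrightarrow> 0 \<le> hinner H x x"
    and hinner_definite: "\<lbrakk>x \<in> carrier H; hinner H x x = 0\<rbrakk> \<Longrightarrow> x = \<zero>"

locale complex_hilbert_space = complex_inner_product_space +
  assumes complete: "Metric_space.mcomplete (carrier H) (hdist H)"

locale star_representation =
  complex_star_algebra scl star + complex_hilbert_space H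
  for scl :: "complex \<Rightarrow> 'a::ring \<Rightarrow> 'a" and star :: "'a \<Rightarrow> 'a"
    and H :: "('h, 'm) inner_space_scheme" (structure) +
  fixes \<pi> :: "'a \<Rightarrow> 'h \<Rightarrow> 'h"
  assumes rep_closed: "x \<in> carrier H \<Longrightarrow> \<pi> a x \<in> carrier H"
    and rep_op_add:
      "\<lbrakk>x \<in> carrier H; y \<in> carrier H\<rbrakk> \<Longrightarrow> \<pi> a (x \<oplus> y) = \<pi> a x \<oplus> \<pi> a y"
    and rep_op_smult: "x \<in> carrier H \<Longrightarrow> \<pi> a (c \<odot> x) = c \<odot> \<pi> a x"
    and rep_bounded: "\<exists>K. \<forall>x\<in>carrier H. hnorm H (\<pi> a x) \<le> K * hnorm H x"
    and rep_add: "x \<in> carrier H \<Longrightarrow> \<pi> (a + b) x = \<pi> a x \<oplus> \<pi> b x"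
    and rep_scale: "x \<in> carrier H \<Longrightarrow> \<pi> (scl c a) x = c \<odot> \<pi> a x"
    and rep_mult: "x \<in> carrier H \<Longrightarrow> \<pi> (a * b) x = \<pi> a (\<pi> b x)"
    and rep_star:
      "\<lbrakk>x \<in> carrier H; y \<in> carrier H\<rbrakk> \<Longrightarrow> hinner H (\<pi> (star a) x) y = hinner H x (\<pi> a y)"

locale cyclic_star_representation = star_representation +
  fixes \<xi>
  assumes cyclic_closed: "\<xi> \<in> carrier H"
    and cyclic:
      "Abstract_Topology.closure_of (Metric_space.mtopology (carrier H) (hdist H))
        (range (\<lambda>a. \<pi> a \<xi>)) = carrier H"

definition positive_functional ::
    "(complex \<Rightarrow> 'a::ring \<Rightarrow> 'a) \<Rightarrow> ('a \<Rightarrow> 'a) \<Rightarrow> ('a \<Rightarrow> complex) \<Rightarrow> bool"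
  where "positive_functional scl star f \<longleftrightarrow>
    Vector_Spaces.linear scl (*) f \<and> (\<forall>a. 0 \<le> f (star a * a))"

definition functional_le :: "('a::ring \<Rightarrow> 'a) \<Rightarrow> ('a \<Rightarrow> complex) \<Rightarrow> ('a \<Rightarrow> complex) \<Rightarrow> bool"
  where "functional_le star f g \<longleftrightarrow> (\<forall>a. f (star a * a) \<le> g (star a * a))"

definition dominated :: "('a::ring \<Rightarrow> 'a) \<Rightarrow> ('a \<Rightarrow> complex) \<Rightarrow> ('a \<Rightarrow> complex) \<Rightarrow> bool"
  where "dominated star f g \<longleftrightarrow>
    (\<exists>c::real. 0 \<le> c \<and> functional_le star f (\<lambda>a. of_real c * g a))"

definition abs_continuous :: "('a::ring \<Rightarrow> 'a) \<Rightarrow> ('a \<Rightarrow> complex) \<Rightarrow> ('a \<Rightarrow> complex) \<Rightarrow> bool"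
  where "abs_continuous star f g \<longleftrightarrow> (\<forall>a. g (star a * a) = 0 \<longrightarrow> f (star a * a) = 0)"

text \<open>
  HOL cannot quantify over types inside a formula, so the Hilbert space of the representation
  has its carrier in the type \<open>nat \<Rightarrow> 'a\<close>.  This is no restriction: by \<open>representableI\<close>
  below, a cyclic representation on a Hilbert space over any type whatsoever will do.
\<close>

definition representable ::
    "(complex \<Rightarrow> 'a::ring \<Rightarrow> 'a) \<Rightarrow> ('a \<Rightarrow> 'a) \<Rightarrow> ('a \<Rightarrow> complex) \<Rightarrow> bool"
  where "representable scl star f \<longleftrightarrow>
    positive_functional scl star f \<and>
    (\<exists>(H :: (nat \<Rightarrow> 'a) inner_space) \<pi> \<xi>.
      cyclic_star_representation scl star H \<pi> \<xi> \<and> (\<forall>a. f a = hinner H (\<pi> a \<xi>) \<xi>))"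

definition singular ::
    "(complex \<Rightarrow> 'a::ring \<Rightarrow> 'a) \<Rightarrow> ('a \<Rightarrow> 'a) \<Rightarrow> ('a \<Rightarrow> complex) \<Rightarrow> ('a \<Rightarrow> complex) \<Rightarrow> bool"
  where "singular scl star f g \<longleftrightarrow>
    {h. representable scl star h \<and> dominated star h f \<and> dominated star h g} = {\<lambda>_. 0}"


context complex_inner_product_space
begin

lemma hinner_zero_left: "y \<in> carrier H \<Longrightarrow> hinner H \<zero> y = 0"
  using hinner_add_left[of \<zero> \<zero> y] by simp

lemma smult_in: "x \<in> carrier H \<Longrightarrow> c \<odot> x \<in> carrier H"
  using smult_closed[of c x] by (simp add: carrier_class)

lemma uminus_eq_smult: "x \<in> carrier H \<Longrightarrow> \<ominus> x = (-1) \<odot> x"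
proof -
  assume x: "x \<in> carrier H"
  have "(-1) \<odot> x \<oplus> x = \<zero>"
    using smult_l_distr[of "-1" 1 x] smult_one[of x] smult_l_null[of x] x
    by (simp add: carrier_class plus_class one_class zero_class)
  then show ?thesis
    using x smult_in by (simp add: M.minus_equality)
qed

lemma hinner_add_right:
  "\<lbrakk>x \<in> carrier H; y \<in> carrier H; z \<in> carrier H\<rbrakk>
    \<Longrightarrow> hinner H z (x \<oplus> y) = hinner H z x + hinner H z y"
  using hinner_commute[of z "x \<oplus> y"] hinner_commute[of z x] hinner_commute[of z y]
    hinner_add_left[of x y z] by simp

lemma hinner_smult_right:
  "\<lbrakk>x \<in> carrier H; y \<in> carrier H\<rbrakk> \<Longrightarrow> hinner H y (c \<odot> x) = cnj c * hinner H y x"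
  using hinner_commute[of y "c \<odot> x"] hinner_commute[of y x] hinner_smult_left[of x y c] smult_in
  by simp

lemma hinner_self: "x \<in> carrier H \<Longrightarrow> hinner H x x = complex_of_real ((hnorm H x)\<^sup>2)"
  using hinner_nonneg[of x] by (simp add: hnorm_def less_eq_complex_def complex_eq_iff)

lemma hnorm_nonneg: "x \<in> carrier H \<Longrightarrow> 0 \<le> hnorm H x"
  using hinner_nonneg[of x] by (simp add: hnorm_def less_eq_complex_def)

lemma hnorm_eq_0: "x \<in> carrier H \<Longrightarrow> hnorm H x = 0 \<longleftrightarrow> x = \<zero>"
  using hinner_self[of x] hinner_definite[of x] hinner_zero_left[of \<zero>]
  by (auto simp: hnorm_def)

lemma cauchy_schwarz:
  assumes x: "x \<in> carrier H" and y: "y \<in> carrier H"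
  shows "cmod (hinner H x y) \<le> hnorm H x * hnorm H y"
proof (cases "y = \<zero>")
  case True
  then have "hinner H x y = 0"
    using hinner_commute[of x y] hinner_zero_left[of x] x y by simp
  then show ?thesis
    using hnorm_nonneg x y by simp
next
  case False
  define p where "p = (hnorm H y)\<^sup>2"
  define w where "w = hinner H x y"
  have p: "p > 0"
    using False hnorm_eq_0[OF y] by (simp add: p_def)
  define c where "c = - w / of_real p"
  define z where "z = x \<oplus> c \<odot> y"
  have cy: "c \<odot> y \<in> carrier H" and z: "z \<in> carrier H"
    using x y smult_in by (auto simp: z_def)
  have wy: "hinner H y x = cnj w"
    using hinner_commute[OF y x] by (simp add: w_def)
  have "hinner H z z = hinner H x x + cnj c * w + c * (cnj w + cnj c * of_real p)"
    using x y cy hinner_self[OF y]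
    by (simp add: z_def hinner_add_left hinner_add_right hinner_smult_left hinner_smult_right
        w_def[symmetric] wy p_def algebra_simps)
  also have "cnj w + cnj c * of_real p = 0"
    using p by (simp add: c_def)
  finally have "hinner H z z = of_real ((hnorm H x)\<^sup>2) - cnj w * w / of_real p"
    using hinner_self[OF x] by (simp add: c_def)
  also have "cnj w * w = of_real ((cmod w)\<^sup>2)"
    by (simp add: complex_norm_square mult.commute of_real_power[symmetric] del: of_real_power)
  finally have "0 \<le> (hnorm H x)\<^sup>2 - (cmod w)\<^sup>2 / p"
    using hinner_nonneg[OF z] by (simp add: less_eq_complex_def)
  then have "(cmod w)\<^sup>2 \<le> (hnorm H x)\<^sup>2 * p"
    using p by (simp add: field_simps)
  then have "(cmod w)\<^sup>2 \<le> (hnorm H x * hnorm H y)\<^sup>2"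
    by (simp add: p_def power_mult_distrib)
  then show ?thesis
    unfolding w_def by (rule power2_le_imp_le) (simp add: hnorm_nonneg x y)
qed

lemma hnorm_triangle:
  assumes x: "x \<in> carrier H" and y: "y \<in> carrier H"
  shows "hnorm H (x \<oplus> y) \<le> hnorm H x + hnorm H y"
proof -
  have "Re (hinner H (x \<oplus> y) (x \<oplus> y))
      = (hnorm H x)\<^sup>2 + (hnorm H y)\<^sup>2 + 2 * Re (hinner H x y)"
    using x y hinner_self[OF x] hinner_self[OF y] hinner_commute[OF y x]
    by (simp add: hinner_add_left hinner_add_right)
  also have "Re (hinner H x y) \<le> hnorm H x * hnorm H y"
    using cauchy_schwarz[OF x y] complex_Re_le_cmod order_trans by blast
  finally have "Re (hinner H (x \<oplus> y) (x \<oplus> y)) \<le> (hnorm H x + hnorm H y)\<^sup>2"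
    by (simp add: power2_sum)
  then have "hnorm H (x \<oplus> y) \<le> sqrt ((hnorm H x + hnorm H y)\<^sup>2)"
    unfolding hnorm_def[of H "x \<oplus> y"] by (rule real_sqrt_le_mono)
  also have "\<dots> = hnorm H x + hnorm H y"
    using hnorm_nonneg[OF x] hnorm_nonneg[OF y] by simp
  finally show ?thesis .
qed

lemma hnorm_uminus: "x \<in> carrier H \<Longrightarrow> hnorm H (\<ominus> x) = hnorm H x"
  by (simp add: hnorm_def uminus_eq_smult smult_in hinner_smult_left hinner_smult_right)

lemma hdist_metric: "Metric_space (carrier H) (hdist H)"
proof
  show "0 \<le> hdist H x y" for x y
    by (simp add: hdist_def hnorm_nonneg)
  show "hdist H x y = hdist H y x" for x y
  proof -
    have "hnorm H (x \<ominus> y) = hnorm H (y \<ominus> x)" if "x \<in> carrier H" "y \<in> carrier H"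
    proof -
      have "\<ominus> (x \<ominus> y) = y \<ominus> x"
        using that by (simp add: a_minus_def M.minus_add M.a_comm)
      then show ?thesis
        using that hnorm_uminus[of "x \<ominus> y"] by simp
    qed
    then show ?thesis
      by (simp add: hdist_def)
  qed
  show "hdist H x y = 0 \<longleftrightarrow> x = y" if "x \<in> carrier H" "y \<in> carrier H" for x y
  proof -
    have "x \<ominus> y = \<zero> \<Longrightarrow> x = y"
      using that M.minus_equality[of x "\<ominus> y"] by (simp add: a_minus_def)
    then show ?thesis
      using that by (auto simp: hdist_def hnorm_eq_0 a_minus_def M.r_neg)
  qed
  show "hdist H x z \<le> hdist H x y + hdist H y z"
    if "x \<in> carrier H" "y \<in> carrier H" "z \<in> carrier H" for x y z
  proof -
    have "x \<ominus> z = (x \<ominus> y) \<oplus> (y \<ominus> z)"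
      using that by (simp add: a_minus_def M.a_assoc M.r_neg1)
    then show ?thesis
      using that hnorm_triangle[of "x \<ominus> y" "y \<ominus> z"] by (simp add: hdist_def)
  qed
qed

end

definition transport :: "('h \<Rightarrow> 'k) \<Rightarrow> ('h, 'm) inner_space_scheme \<Rightarrow> 'k inner_space"
  where "transport e H = (let r = inv_into (carrier H) e in
    \<lparr>carrier = e ` carrier H, mult = (\<lambda>x y. x), one = e \<zero>\<^bsub>H\<^esub>, zero = e \<zero>\<^bsub>H\<^esub>,
      add = (\<lambda>x y. e (r x \<oplus>\<^bsub>H\<^esub> r y)), smult = (\<lambda>c x. e (c \<odot>\<^bsub>H\<^esub> r x)),
      hinner = (\<lambda>x y. hinner H (r x) (r y))\<rparr>)"

context complex_hilbert_space
begin

context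
  fixes e :: "'a \<Rightarrow> 'k"
  assumes inj: "inj_on e (carrier H)"
begin

lemma transport_inv: "x \<in> carrier H \<Longrightarrow> inv_into (carrier H) e (e x) = x"
  using inj by simp

lemma transport_simps:
  "carrier (transport e H) = e ` carrier H"
  "\<zero>\<^bsub>transport e H\<^esub> = e \<zero>"
  "\<lbrakk>x \<in> carrier H; y \<in> carrier H\<rbrakk> \<Longrightarrow> e x \<oplus>\<^bsub>transport e H\<^esub> e y = e (x \<oplus> y)"
  "x \<in> carrier H \<Longrightarrow> c \<odot>\<^bsub>transport e H\<^esub> e x = e (c \<odot> x)"
  "\<lbrakk>x \<in> carrier H; y \<in> carrier H\<rbrakk> \<Longrightarrow> hinner (transport e H) (e x) (e y) = hinner H x y"
  "x \<in> carrier H \<Longrightarrow> hnorm (transport e H) (e x) = hnorm H x"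
  by (simp_all add: transport_def Let_def transport_inv hnorm_def)

lemma transport_abelian_group: "abelian_group (transport e H)"
proof (rule abelian_groupI)
  fix x assume "x \<in> carrier (transport e H)"
  then obtain x' where x': "x' \<in> carrier H" "x = e x'"
    by (auto simp: transport_simps)
  then have "e (\<ominus> x') \<oplus>\<^bsub>transport e H\<^esub> x = \<zero>\<^bsub>transport e H\<^esub>"
    by (simp add: transport_simps M.l_neg)
  then show "\<exists>y\<in>carrier (transport e H). y \<oplus>\<^bsub>transport e H\<^esub> x = \<zero>\<^bsub>transport e H\<^esub>"
    using x' by (auto simp: transport_simps)
qed (auto simp: transport_simps M.a_ac)

lemma transport_module: "Module.module cring_class_ops (transport e H)"
  using transport_abelian_group
  by (intro moduleI)
    (auto simp: transport_simps cring_class carrier_class smult_in smult_l_distr smult_r_distr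
      smult_assoc1)

lemma transport_inner_product_space: "complex_inner_product_space (transport e H)"
  by (intro complex_inner_product_space.intro transport_module
      complex_inner_product_space_axioms.intro)
    (auto simp: transport_simps smult_in hinner_add_left hinner_smult_left hinner_nonneg
      intro: hinner_commute dest: hinner_definite)

lemma transport_minus:
  assumes "x \<in> carrier H" "y \<in> carrier H"
  shows "e x \<ominus>\<^bsub>transport e H\<^esub> e y = e (x \<ominus> y)"
proof -
  interpret T: complex_inner_product_space "transport e H"
    by (rule transport_inner_product_space)
  have "\<ominus>\<^bsub>transport e H\<^esub> e y = e (\<ominus> y)"
    using assms by (simp add: T.uminus_eq_smult uminus_eq_smult transport_simps)
  then show ?thesis
    using assms by (simp add: a_minus_def transport_simps)
qed

lemma transport_hdist:
  "\<lbrakk>x \<in> carrier H; y \<in> carrier H\<rbrakk> \<Longrightarrow> hdist (transport e H) (e x) (e y) = hdist H x y"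
  by (simp add: hdist_def transport_simps transport_minus)

lemma transport_hilbert_space: "complex_hilbert_space (transport e H)"
proof -
  interpret T: complex_inner_product_space "transport e H"
    by (rule transport_inner_product_space)
  interpret D: Metric_space "carrier H" "hdist H"
    by (rule hdist_metric)
  interpret E: Metric_space "carrier (transport e H)" "hdist (transport e H)"
    by (rule T.hdist_metric)
  have "E.mcomplete"
    unfolding E.mcomplete_def
  proof (intro allI impI)
    fix \<sigma> assume \<sigma>: "E.MCauchy \<sigma>"
    define \<tau> where "\<tau> n = inv_into (carrier H) e (\<sigma> n)" for n
    have "range \<sigma> \<subseteq> carrier (transport e H)"
      using \<sigma> unfolding E.MCauchy_def by blast
    then have "\<sigma> n \<in> e ` carrier H" for n
      by (auto simp: transport_simps)
    then have \<tau>: "\<tau> n \<in> carrier H" "\<sigma> n = e (\<tau> n)" for n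
      by (auto simp: \<tau>_def inv_into_into f_inv_into_f)
    have "D.MCauchy \<tau>"
      using \<sigma> \<tau> unfolding E.MCauchy_def D.MCauchy_def by (auto simp: transport_hdist)
    then obtain x where x: "limitin D.mtopology \<tau> x sequentially"
      using complete D.mcomplete_def by blast
    then have "limitin E.mtopology \<sigma> (e x) sequentially"
      using \<tau> unfolding E.limitin_metric D.limitin_metric
      by (auto simp: transport_simps transport_hdist)
    then show "\<exists>x. limitin E.mtopology \<sigma> x sequentially"
      by blast
  qed
  then show ?thesis
    by (intro complex_hilbert_space.intro transport_inner_product_space
        complex_hilbert_space_axioms.intro)
qed

end

end

lemma (in cyclic_star_representation) transport_representation:
  assumes inj: "inj_on e (carrier H)"
  shows "cyclic_star_representation scl star (transport e H)
    (\<lambda>a x. e (\<pi> a (inv_into (carrier H) e x))) (e \<xi>)"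
proof -
  note simps = transport_simps[OF inj] transport_inv[OF inj]
  interpret T: complex_hilbert_space "transport e H"
    by (rule transport_hilbert_space[OF inj])
  interpret D: Metric_space "carrier H" "hdist H"
    by (rule hdist_metric)
  interpret E: Metric_space "carrier (transport e H)" "hdist (transport e H)"
    by (rule T.hdist_metric)
  have bounded: "\<exists>K. \<forall>x\<in>carrier (transport e H).
      hnorm (transport e H) (e (\<pi> a (inv_into (carrier H) e x))) \<le> K * hnorm (transport e H) x" for a
    using rep_bounded[of a] by (auto simp: simps rep_closed)
  have rep: "star_representation scl star (transport e H)
      (\<lambda>a x. e (\<pi> a (inv_into (carrier H) e x)))"
    by (intro star_representation.intro star_representation_axioms.intro bounded
        complex_star_algebra_axioms T.complex_hilbert_space_axioms)
      (auto simp: simps smult_in rep_closed rep_op_add rep_op_smult rep_add rep_scale rep_mult rep_star)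
  have "y \<in> Abstract_Topology.closure_of E.mtopology (range (\<lambda>a. e (\<pi> a \<xi>)))"
    if yH: "y \<in> carrier (transport e H)" for y
    unfolding E.metric_closure_of
  proof (safe intro!: yH)
    fix d :: real assume "d > 0"
    obtain x where x: "x \<in> carrier H" "y = e x"
      using yH by (auto simp: simps)
    then have "x \<in> Abstract_Topology.closure_of D.mtopology (range (\<lambda>a. \<pi> a \<xi>))"
      using cyclic by simp
    then obtain a where "hdist H x (\<pi> a \<xi>) < d"
      unfolding D.metric_closure_of using \<open>d > 0\<close> by auto
    then have "e (\<pi> a \<xi>) \<in> E.mball y d"
      using x yH by (simp only: E.in_mball transport_hdist[OF inj] rep_closed cyclic_closed)
        (simp add: simps rep_closed cyclic_closed)
    then show "\<exists>y'\<in>range (\<lambda>a. e (\<pi> a \<xi>)). y' \<in> E.mball y d"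
      by blast
  qed
  moreover have "Abstract_Topology.closure_of E.mtopology (range (\<lambda>a. e (\<pi> a \<xi>)))
      \<subseteq> carrier (transport e H)"
    unfolding E.metric_closure_of by blast
  ultimately have "Abstract_Topology.closure_of E.mtopology
      (range (\<lambda>a. e (\<pi> a (inv_into (carrier H) e (e \<xi>))))) = carrier (transport e H)"
    by (auto simp only: transport_inv[OF inj] cyclic_closed)
  then show ?thesis
    using rep
    by (intro cyclic_star_representation.intro cyclic_star_representation_axioms.intro)
      (auto simp: simps cyclic_closed)
qed

lemma representableI:
  fixes H :: "('h, 'm) inner_space_scheme"
  assumes pos: "positive_functional scl star f"
    and rep: "cyclic_star_representation scl star H \<pi> \<xi>"
    and f: "\<And>a. f a = hinner H (\<pi> a \<xi>) \<xi>"
  shows "representable scl star f"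
proof -
  interpret cyclic_star_representation scl star H \<pi> \<xi>
    by (rule rep)
  interpret D: Metric_space "carrier H" "hdist H"
    by (rule hdist_metric)
  have "\<exists>s. \<forall>n. hdist H x (\<pi> (s n) \<xi>) < inverse (real (Suc n))" if "x \<in> carrier H" for x
  proof -
    have "\<exists>a. hdist H x (\<pi> a \<xi>) < inverse (real (Suc n))" for n
    proof -
      have "x \<in> Abstract_Topology.closure_of D.mtopology (range (\<lambda>a. \<pi> a \<xi>))"
        using cyclic that by simp
      moreover have "0 < inverse (real (Suc n))"
        by simp
      ultimately obtain a where "\<pi> a \<xi> \<in> D.mball x (inverse (real (Suc n)))"
        unfolding D.metric_closure_of by blast
      then show ?thesis
        unfolding D.in_mball by blast
    qed
    then show ?thesis
      by metis
  qed
  then obtain e where e: "hdist H x (\<pi> (e x n) \<xi>) < inverse (real (Suc n))"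
    if "x \<in> carrier H" for x n
    by metis
  have "inj_on e (carrier H)"
  proof (rule inj_onI, rule ccontr)
    fix x y assume xy: "x \<in> carrier H" "y \<in> carrier H" "e x = e y" "x \<noteq> y"
    then have "0 < hdist H x y / 2"
      by simp
    then obtain n where n: "inverse (real (Suc n)) < hdist H x y / 2"
      using reals_Archimedean by blast
    have "hdist H x y \<le> hdist H x (\<pi> (e x n) \<xi>) + hdist H y (\<pi> (e y n) \<xi>)"
      using D.triangle'[of x "\<pi> (e x n) \<xi>" y] xy rep_closed cyclic_closed by simp
    then show False
      using e[of x n] e[of y n] xy n by linarith
  qed
  note T = transport_representation[OF this] transport_simps[OF this] transport_inv[OF this]
  have "f a = hinner (transport e H) (e (\<pi> a (inv_into (carrier H) e (e \<xi>)))) (e \<xi>)" for a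
    by (simp add: T cyclic_closed rep_closed f)
  with pos T(1) show ?thesis
    unfolding representable_def by (intro conjI exI[of _ "transport e H"] exI) auto
qed

end

theory Submission
  imports Defs
begin

text \<open>
  Represent \<open>f\<close> by a cyclic representation \<open>\<pi>\<close> with cyclic vector \<open>\<xi>\<close>.  Since \<open>g\<close> is
  representable, \<open>{k. g (k\<^sup>* k) = 0}\<close> is a left ideal, so the closure \<open>M\<close> of the vectors
  \<open>\<pi> k \<xi>\<close> with \<open>k\<close> in it is a \<open>\<pi>\<close>-invariant subspace.  Splitting \<open>\<xi> = p + q\<close> along \<open>M\<close>
  and its orthogonal complement gives the singular part \<open>(\<pi> a p | p)\<close> and the absolutely
  continuous part \<open>(\<pi> a q | q)\<close>.  If \<open>h \<le> f\<close> is \<open>g\<close>-absolutely continuous, the seminorm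
  \<open>sqrt (h (a\<^sup>* a))\<close> vanishes at such \<open>k\<close> and hence is at most the distance of \<open>\<pi> a \<xi>\<close>
  from \<open>M\<close>, which is the norm of \<open>\<pi> a q\<close>.  If \<open>h\<close> is dominated by \<open>g\<close> and by the singular
  part, the same estimate gives \<open>0\<close>, because \<open>\<pi> a p\<close> lies in \<open>M\<close>.
\<close>

text \<open>Closed subspaces enter the proof only as orthogonal complements. The closure
  \<open>M\<close> of a subspace \<open>S\<close> appears as \<open>orth H (orth H S)\<close>, so
  completeness and invariance have to be shown for complements only.\<close>

definition orth :: "('h, 'm) inner_space_scheme \<Rightarrow> 'h set \<Rightarrow> 'h set"
  where "orth H S = {y \<in> carrier H. \<forall>s\<in>S. hinner H y s = 0}"

text \<open>The sign of \<open>b\<close> is arbitrary: \<epsilon> = 1 settles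
  \<open>b \<le> 0\<close>, and for \<open>b > 0\<close> a positive \<open>a\<close> would satisfy
  \<open>a \<le> a / 2\<close>.\<close>

lemma le_zero_if_le_epsilon_mult:
  fixes a b :: real
  assumes "\<And>\<epsilon>. \<epsilon> > 0 \<Longrightarrow> a \<le> \<epsilon> * b"
  shows "a \<le> 0"
proof (rule ccontr)
  assume "\<not> a \<le> 0"
  then show False
    using assms[of 1] assms[of "a / (2 * b)"] by auto
qed

section \<open>Orthogonal complements in inner product spaces\<close>

context complex_inner_product_space
begin

lemma hinner_minus_left:
  "\<lbrakk>x \<in> carrier H; y \<in> carrier H; z \<in> carrier H\<rbrakk>
    \<Longrightarrow> hinner H (x \<ominus> y) z = hinner H x z - hinner H y z"
  by (simp add: a_minus_def hinner_add_left uminus_eq_smult hinner_smult_left smult_in)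

lemma hinner_minus_right:
  "\<lbrakk>x \<in> carrier H; y \<in> carrier H; z \<in> carrier H\<rbrakk>
    \<Longrightarrow> hinner H z (x \<ominus> y) = hinner H z x - hinner H z y"
  by (simp add: a_minus_def hinner_add_right uminus_eq_smult hinner_smult_right smult_in)

lemma hinner_zero_right: "y \<in> carrier H \<Longrightarrow> hinner H y \<zero> = 0"
  using hinner_commute[of y \<zero>] hinner_zero_left[of y] by simp

text \<open>A quantitative form of "shortest means orthogonal". Subtracting the projection of
  \<open>y\<close> onto the line through \<open>s\<close> lowers the squared norm by exactly
  \<open>(cmod (hinner H y s))\<^sup>2 / (hnorm H s)\<^sup>2\<close>, and \<open>min\<close> bounds
  this gain by \<open>e\<^sup>2\<close>.\<close>

lemma hinner_nearly_minimal:
  assumes y: "y \<in> carrier H" and s: "s \<in> carrier H" and e: "0 \<le> e"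
    and min: "\<And>c. (hnorm H y)\<^sup>2 \<le> (hnorm H (y \<ominus> c \<odot> s))\<^sup>2 + e\<^sup>2"
  shows "cmod (hinner H y s) \<le> e * hnorm H s"
proof (cases "s = \<zero>")
  case True
  then show ?thesis
    using y s e hnorm_nonneg by (simp add: hinner_zero_right)
next
  case False
  define r where "r = (hnorm H s)\<^sup>2"
  define w where "w = hinner H y s"
  have r: "r > 0"
    using False hnorm_eq_0[OF s] by (simp add: r_def)
  \<comment> \<open>\<open>c \<odot> s\<close> is the orthogonal projection of \<open>y\<close> onto
    the line through \<open>s\<close>.\<close>
  define c where "c = w / of_real r"
  have cs: "c \<odot> s \<in> carrier H"
    using s smult_in by simp
  have sy: "hinner H s y = cnj w"
    using hinner_commute[OF s y] by (simp add: w_def)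
  have "hinner H (y \<ominus> c \<odot> s) (y \<ominus> c \<odot> s)
      = hinner H y y - cnj c * w - c * (cnj w - cnj c * of_real r)"
    using y s cs hinner_self[OF s]
    by (simp add: hinner_minus_left hinner_minus_right hinner_smult_left hinner_smult_right
        w_def[symmetric] sy r_def algebra_simps)
  also have "cnj w - cnj c * of_real r = 0"
    using r by (simp add: c_def)
  finally have "complex_of_real ((hnorm H (y \<ominus> c \<odot> s))\<^sup>2)
      = of_real ((hnorm H y)\<^sup>2) - cnj w * w / of_real r"
    using hinner_self[OF y] hinner_self[of "y \<ominus> c \<odot> s"] y cs by (simp add: c_def)
  also have "cnj w * w = of_real ((cmod w)\<^sup>2)"
    by (simp add: complex_norm_square mult.commute of_real_power[symmetric] del: of_real_power)
  also have "complex_of_real ((hnorm H y)\<^sup>2) - of_real ((cmod w)\<^sup>2) / of_real r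
      = of_real ((hnorm H y)\<^sup>2 - (cmod w)\<^sup>2 / r)"
    by simp
  finally have "(hnorm H (y \<ominus> c \<odot> s))\<^sup>2 = (hnorm H y)\<^sup>2 - (cmod w)\<^sup>2 / r"
    by (simp only: of_real_eq_iff)
  then have "(cmod w)\<^sup>2 / r \<le> e\<^sup>2"
    using min[of c] by simp
  then have "(cmod w)\<^sup>2 \<le> (e * hnorm H s)\<^sup>2"
    using r by (simp add: field_simps r_def)
  then show ?thesis
    unfolding w_def by (rule power2_le_imp_le) (simp add: hnorm_nonneg s e)
qed

lemma orth_subset: "orth H S \<subseteq> carrier H"
  by (auto simp: orth_def)

lemma orth_add: "\<lbrakk>S \<subseteq> carrier H; x \<in> orth H S; y \<in> orth H S\<rbrakk> \<Longrightarrow> x \<oplus> y \<in> orth H S"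
  by (auto simp: orth_def hinner_add_left subset_iff)

lemma orth_smult: "\<lbrakk>S \<subseteq> carrier H; x \<in> orth H S\<rbrakk> \<Longrightarrow> c \<odot> x \<in> orth H S"
  by (auto simp: orth_def hinner_smult_left smult_in subset_iff)

lemma orth_zero: "S \<subseteq> carrier H \<Longrightarrow> \<zero> \<in> orth H S"
  by (auto simp: orth_def hinner_zero_left subset_iff)

lemma orth_orth_superset:
  assumes "S \<subseteq> carrier H"
  shows "S \<subseteq> orth H (orth H S)"
proof
  fix s assume s: "s \<in> S"
  have "hinner H s y = 0" if "y \<in> orth H S" for y
    using that s assms hinner_commute[of s y] by (auto simp: orth_def)
  then show "s \<in> orth H (orth H S)"
    using s assms by (auto simp: orth_def)
qed

text \<open>Complements are closed: for \<open>y\<close> in the complement, \<open>x\<close> and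
  \<open>x \<ominus> y\<close> have the same inner product with \<open>s\<close>, and Cauchy-Schwarz
  makes the latter small.\<close>

lemma orth_limit:
  assumes S: "S \<subseteq> carrier H" and x: "x \<in> carrier H"
    and lim: "\<And>\<epsilon>. \<epsilon> > 0 \<Longrightarrow> \<exists>y\<in>orth H S. hnorm H (x \<ominus> y) < \<epsilon>"
  shows "x \<in> orth H S"
proof -
  have "hinner H x s = 0" if s: "s \<in> S" for s
  proof -
    have sc: "s \<in> carrier H"
      using S s by blast
    have "cmod (hinner H x s) \<le> \<epsilon> * hnorm H s" if "\<epsilon> > 0" for \<epsilon>
    proof -
      obtain y where y: "y \<in> orth H S" "hnorm H (x \<ominus> y) < \<epsilon>"
        using lim \<open>\<epsilon> > 0\<close> by blast
      then have yc: "y \<in> carrier H" and ys: "hinner H y s = 0"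
        using s by (auto simp: orth_def)
      then have "cmod (hinner H x s) = cmod (hinner H (x \<ominus> y) s)"
        using x sc by (simp add: hinner_minus_left)
      also have "\<dots> \<le> hnorm H (x \<ominus> y) * hnorm H s"
        using cauchy_schwarz x yc sc by simp
      also have "\<dots> \<le> \<epsilon> * hnorm H s"
        using y(2) hnorm_nonneg[OF sc] by (intro mult_right_mono) auto
      finally show ?thesis .
    qed
    then have "cmod (hinner H x s) \<le> 0"
      by (rule le_zero_if_le_epsilon_mult)
    then show ?thesis
      by simp
  qed
  then show ?thesis
    using x by (simp add: orth_def)
qed

end

section \<open>Orthogonal projection onto the closure of a subspace\<close>

context complex_hilbert_space
begin

text \<open>A sequence in \<open>S\<close> minimizing the distance to \<open>x\<close> is Cauchy,
  and its limit is \<open>p\<close>. Since \<open>S\<close> need not be closed, \<open>p\<close> may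
  lie outside \<open>S\<close>; the last conclusion records that it lies in the closure.\<close>

lemma orth_decomposition:
  assumes S: "S \<subseteq> carrier H" "\<zero> \<in> S"
    and add: "\<And>s t. \<lbrakk>s \<in> S; t \<in> S\<rbrakk> \<Longrightarrow> s \<oplus> t \<in> S"
    and smult: "\<And>c s. s \<in> S \<Longrightarrow> c \<odot> s \<in> S"
    and x: "x \<in> carrier H"
  obtains p q where "p \<in> orth H (orth H S)" "q \<in> orth H S" "x = p \<oplus> q"
    "\<And>\<epsilon>. \<epsilon> > 0 \<Longrightarrow> \<exists>s\<in>S. hnorm H (p \<ominus> s) < \<epsilon>"
proof -
  interpret D: Metric_space "carrier H" "hdist H"
    by (rule hdist_metric)
  have minus: "s \<ominus> t \<in> S" if "s \<in> S" "t \<in> S" for s t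
    using that add[OF _ smult[of t "-1"]] S by (auto simp: a_minus_def uminus_eq_smult)
  define d where "d = (INF s\<in>S. (hnorm H (x \<ominus> s))\<^sup>2)"
  have bdd: "bdd_below ((\<lambda>s. (hnorm H (x \<ominus> s))\<^sup>2) ` S)"
    by (rule bdd_belowI[of _ 0]) auto
  have d_le: "d \<le> (hnorm H (x \<ominus> s))\<^sup>2" if "s \<in> S" for s
    unfolding d_def using that bdd by (rule cINF_lower[rotated])
  define e where "e n = inverse (real (Suc n))" for n
  have e: "e n > 0" for n
    by (simp add: e_def)
  have "\<exists>s\<in>S. (hnorm H (x \<ominus> s))\<^sup>2 < d + (e n)\<^sup>2" for n
  proof -
    have "d < d + (e n)\<^sup>2"
      using e[of n] by simp
    then show ?thesis
      unfolding d_def using cINF_less_iff[OF _ bdd] S by blast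
  qed
  then obtain u where u: "\<And>n. u n \<in> S" "\<And>n. (hnorm H (x \<ominus> u n))\<^sup>2 < d + (e n)\<^sup>2"
    by metis
  have uc: "u n \<in> carrier H" for n
    using u S by blast
  \<comment> \<open>Moving from \<open>u n\<close> by a multiple of \<open>s\<close> stays in
    \<open>S\<close>, so the squared distance to \<open>x\<close> cannot fall below
    \<open>d\<close>. The slack \<open>(e n)\<^sup>2\<close> in the choice of \<open>u n\<close>
    becomes the factor \<open>e n\<close> here.\<close>
  have near: "cmod (hinner H (x \<ominus> u n) s) \<le> e n * hnorm H s" if s: "s \<in> S" for n s
  proof (rule hinner_nearly_minimal)
    fix c
    have cs: "c \<odot> s \<in> S"
      using s smult by blast
    have "x \<ominus> u n \<ominus> c \<odot> s = x \<ominus> (u n \<oplus> c \<odot> s)"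
      using x uc cs S by (simp add: a_minus_def M.minus_add M.a_assoc subset_iff)
    then show "(hnorm H (x \<ominus> u n))\<^sup>2 \<le> (hnorm H (x \<ominus> u n \<ominus> c \<odot> s))\<^sup>2 + (e n)\<^sup>2"
      using d_le[of "u n \<oplus> c \<odot> s"] u[of n] add cs by fastforce
  qed (use s S x uc e[of n] in auto)
  have dist_u: "hnorm H (u n \<ominus> u m) \<le> e n + e m" for n m
  proof -
    define t where "t = u n \<ominus> u m"
    have t: "t \<in> S" "t \<in> carrier H"
      using minus u S by (auto simp: t_def)
    \<comment> \<open>\<open>t\<close> lies in \<open>S\<close> and is the difference of two
      residuals that are nearly orthogonal to \<open>S\<close>. This takes the place of the
      parallelogram law.\<close>
    have "hinner H t t = hinner H (x \<ominus> u m) t - hinner H (x \<ominus> u n) t"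
      using uc x t by (subst t_def) (simp add: hinner_minus_left)
    then have "cmod (hinner H t t) \<le> cmod (hinner H (x \<ominus> u m) t) + cmod (hinner H (x \<ominus> u n) t)"
      using norm_triangle_ineq4 by simp
    then have "(hnorm H t)\<^sup>2 \<le> e m * hnorm H t + e n * hnorm H t"
      using near[OF t(1), of m] near[OF t(1), of n] hinner_self[OF t(2)] 
      by (simp add: norm_power hnorm_nonneg t)
    then have "hnorm H t * hnorm H t \<le> (e n + e m) * hnorm H t"
      unfolding monoid_mult_class.power2_eq_square by (simp add: algebra_simps)
    then show ?thesis
      unfolding t_def[symmetric] using e[of n] e[of m] hnorm_nonneg[OF t(2)]
      by (cases "hnorm H t = 0") auto
  qed
  have "D.MCauchy u"
    unfolding D.MCauchy_def
  proof (intro conjI allI impI)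
    show "range u \<subseteq> carrier H"
      using uc by blast
    fix \<epsilon> :: real assume "\<epsilon> > 0"
    then obtain N where N: "e N < \<epsilon> / 2"
      unfolding e_def using reals_Archimedean[of "\<epsilon> / 2"] by auto
    have "hdist H (u n) (u m) < \<epsilon>" if "N \<le> n" "N \<le> m" for n m
    proof -
      have "e n \<le> e N" "e m \<le> e N"
        using that by (auto simp: e_def field_simps)
      then show ?thesis
        using dist_u[of n m] N uc by (simp add: hdist_def)
    qed
    then show "\<exists>N. \<forall>n n'. N \<le> n \<longrightarrow> N \<le> n' \<longrightarrow> hdist H (u n) (u n') < \<epsilon>"
      by blast
  qed
  then obtain p where lim: "limitin D.mtopology u p sequentially"
    using complete D.mcomplete_def by blast
  then have p: "p \<in> carrier H"
    unfolding D.limitin_metric by blast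
  have limp: "\<forall>\<^sub>F n in sequentially. hnorm H (p \<ominus> u n) < \<epsilon>" if "\<epsilon> > 0" for \<epsilon>
  proof -
    have "\<forall>\<^sub>F n in sequentially. u n \<in> carrier H \<and> hdist H (u n) p < \<epsilon>"
      using lim that unfolding D.limitin_metric by blast
    then show ?thesis
    proof eventually_elim
      case (elim n)
      then show ?case
        using p D.commute[of p "u n"] by (auto simp: hdist_def)
    qed
  qed
  have approx: "\<exists>s\<in>S. hnorm H (p \<ominus> s) < \<epsilon>" if "\<epsilon> > 0" for \<epsilon>
    using eventually_happens'[OF _ limp[OF that]] u by auto
  have "hinner H (x \<ominus> p) s = 0" if s: "s \<in> S" for s
  proof -
    have sc: "s \<in> carrier H"
      using s S by blast
    have "cmod (hinner H (x \<ominus> p) s) \<le> \<epsilon> * (2 * hnorm H s)" if \<epsilon>: "\<epsilon> > 0" for \<epsilon>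
    proof -
      have "\<forall>\<^sub>F n in sequentially. e n < \<epsilon>"
        unfolding e_def using order_tendstoD(2)[OF LIMSEQ_inverse_real_of_nat \<epsilon>] by simp
      from eventually_happens'[OF _ eventually_conj[OF this limp[OF \<epsilon>]]]
      obtain n where n: "e n < \<epsilon>" "hnorm H (p \<ominus> u n) < \<epsilon>"
        by auto
      have "hinner H (x \<ominus> p) s = hinner H (x \<ominus> u n) s - hinner H (p \<ominus> u n) s"
        using x p uc sc by (simp add: hinner_minus_left)
      then have "cmod (hinner H (x \<ominus> p) s)
          \<le> cmod (hinner H (x \<ominus> u n) s) + cmod (hinner H (p \<ominus> u n) s)"
        using norm_triangle_ineq4 by simp
      also have "\<dots> \<le> e n * hnorm H s + hnorm H (p \<ominus> u n) * hnorm H s"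
        using near[OF s] cauchy_schwarz p uc sc by (intro add_mono) auto
      also have "\<dots> \<le> \<epsilon> * hnorm H s + \<epsilon> * hnorm H s"
        using n hnorm_nonneg[OF sc] by (intro add_mono mult_right_mono) auto
      finally show ?thesis
        by simp
    qed
    then have "cmod (hinner H (x \<ominus> p) s) \<le> 0"
      by (rule le_zero_if_le_epsilon_mult)
    then show ?thesis
      by simp
  qed
  then have q: "x \<ominus> p \<in> orth H S"
    using x p by (simp add: orth_def)
  have "p \<in> orth H (orth H S)"
    by (rule orth_limit) (use p approx orth_orth_superset[OF S(1)] orth_subset in blast)+
  moreover have "x = p \<oplus> (x \<ominus> p)"
    using x p by (simp add: a_minus_def M.r_neg M.a_lcomm[of p x])
  ultimately show thesis
    using that q approx by blast
qed

section \<open>Orthogonal complements as Hilbert spaces\<close>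

context
  fixes S
  assumes S: "S \<subseteq> carrier H"
begin

lemma orth_inner_product_space: "complex_inner_product_space (H\<lparr>carrier := orth H S\<rparr>)"
proof -
  have "abelian_group (H\<lparr>carrier := orth H S\<rparr>)"
  proof (rule abelian_groupI)
    fix x assume "x \<in> carrier (H\<lparr>carrier := orth H S\<rparr>)"
    then have x: "x \<in> orth H S" "x \<in> carrier H"
      by (auto simp: orth_def)
    have "\<ominus> x \<oplus> x = \<zero>"
      using x(2) by (rule M.l_neg)
    moreover have "\<ominus> x \<in> orth H S"
      using orth_smult[OF S x(1), of "-1"] x(2) by (simp add: uminus_eq_smult)
    ultimately show "\<exists>y\<in>carrier (H\<lparr>carrier := orth H S\<rparr>).
        y \<oplus>\<^bsub>H\<lparr>carrier := orth H S\<rparr>\<^esub> x = \<zero>\<^bsub>H\<lparr>carrier := orth H S\<rparr>\<^esub>"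
      by auto
  qed (use S in \<open>auto simp: orth_add orth_zero M.a_ac subsetD[OF orth_subset]\<close>)
  then have "Module.module cring_class_ops (H\<lparr>carrier := orth H S\<rparr>)"
    using S
    by (intro moduleI)
      (auto simp: cring_class carrier_class orth_smult subsetD[OF orth_subset] smult_l_distr
        smult_r_distr smult_assoc1)
  then show ?thesis
    by (intro complex_inner_product_space.intro complex_inner_product_space_axioms.intro)
      (auto simp: hinner_add_left hinner_smult_left hinner_nonneg subsetD[OF orth_subset]
        intro: hinner_commute hinner_definite)
qed

text \<open>The additive inverse of a structure depends on its carrier, so the two differences must
  be identified first. Both inverses are multiplication by -1, which does not depend on the
  carrier.\<close>

lemma orth_hdist:
  assumes "x \<in> orth H S" "y \<in> orth H S"
  shows "hdist (H\<lparr>carrier := orth H S\<rparr>) x y = hdist H x y"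
proof -
  interpret T: complex_inner_product_space "H\<lparr>carrier := orth H S\<rparr>"
    by (rule orth_inner_product_space)
  have "\<ominus>\<^bsub>H\<lparr>carrier := orth H S\<rparr>\<^esub> y = \<ominus> y"
    using assms T.uminus_eq_smult[of y] by (simp add: uminus_eq_smult subsetD[OF orth_subset])
  then show ?thesis
    using assms by (simp add: hdist_def hnorm_def a_minus_def subsetD[OF orth_subset])
qed

text \<open>A Cauchy sequence in the complement converges in \<open>H\<close>, and
  \<open>orth_limit\<close> keeps the limit in the complement.\<close>

lemma orth_hilbert_space: "complex_hilbert_space (H\<lparr>carrier := orth H S\<rparr>)"
proof -
  interpret T: complex_inner_product_space "H\<lparr>carrier := orth H S\<rparr>"
    by (rule orth_inner_product_space)
  interpret D: Metric_space "carrier H" "hdist H"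
    by (rule hdist_metric)
  interpret E: Metric_space "orth H S" "hdist (H\<lparr>carrier := orth H S\<rparr>)"
    using T.hdist_metric by simp
  have "E.mcomplete"
    unfolding E.mcomplete_def
  proof (intro allI impI)
    fix \<sigma> assume \<sigma>: "E.MCauchy \<sigma>"
    then have \<sigma>S: "\<sigma> n \<in> orth H S" for n
      unfolding E.MCauchy_def by blast
    then have "D.MCauchy \<sigma>"
      using \<sigma> orth_subset unfolding E.MCauchy_def D.MCauchy_def by (auto simp: orth_hdist)
    then obtain x where lim: "limitin D.mtopology \<sigma> x sequentially"
      using complete D.mcomplete_def by blast
    then have x: "x \<in> carrier H"
      unfolding D.limitin_metric by blast
    have "x \<in> orth H S"
    proof (rule orth_limit[OF S x])
      fix \<epsilon> :: real assume "\<epsilon> > 0"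
      then obtain n where "\<sigma> n \<in> carrier H" "hdist H (\<sigma> n) x < \<epsilon>"
        using lim eventually_happens'[OF sequentially_bot] unfolding D.limitin_metric by blast
      then have "hnorm H (x \<ominus> \<sigma> n) < \<epsilon>"
        using x D.commute[of x "\<sigma> n"] by (simp add: hdist_def)
      then show "\<exists>y\<in>orth H S. hnorm H (x \<ominus> y) < \<epsilon>"
        using \<sigma>S by blast
    qed
    then have "limitin E.mtopology \<sigma> x sequentially"
      using lim \<sigma>S unfolding E.limitin_metric D.limitin_metric
      by (auto simp: orth_hdist elim: eventually_mono)
    then show "\<exists>x. limitin E.mtopology \<sigma> x sequentially"
      by blast
  qed
  then show ?thesis
    by (intro complex_hilbert_space.intro orth_inner_product_space
        complex_hilbert_space_axioms.intro) simp
qed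

end

end

section \<open>Subrepresentations and the functionals and seminorms of representations\<close>

context star_representation
begin

text \<open>The adjoint of \<open>\<pi> a\<close> is \<open>\<pi> (star a)\<close>, which also maps
  \<open>S\<close> into itself.\<close>

lemma rep_orth:
  assumes "S \<subseteq> carrier H" "\<And>a s. s \<in> S \<Longrightarrow> \<pi> a s \<in> S" "x \<in> orth H S"
  shows "\<pi> a x \<in> orth H S"
proof -
  have "hinner H (\<pi> a x) s = 0" if "s \<in> S" for s
    using rep_star[of x s "star a"] assms that by (auto simp: star_star orth_def subset_iff)
  then show ?thesis
    using assms(3) by (simp add: orth_def rep_closed)
qed

lemma hinner_rep_star_mult:
  "x \<in> carrier H \<Longrightarrow> hinner H (\<pi> (star a * a) x) x = of_real ((hnorm H (\<pi> a x))\<^sup>2)"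
  by (simp add: rep_mult rep_star rep_closed hinner_self)

lemma rep_minus: "x \<in> carrier H \<Longrightarrow> \<pi> (a - b) x = \<pi> a x \<ominus> \<pi> b x"
  using rep_add[of x a "scl (-1) b"] rep_scale[of x "-1" b]
  by (simp add: scale_minus_left a_minus_def uminus_eq_smult rep_closed)

lemma positive_functional_vector:
  assumes x: "x \<in> carrier H"
  shows "positive_functional scl star (\<lambda>a. hinner H (\<pi> a x) x)"
proof -
  have "Vector_Spaces.linear scl (*) (\<lambda>a. hinner H (\<pi> a x) x)"
    by unfold_locales
      (simp_all add: x algebra_simps rep_add rep_scale hinner_add_left hinner_smult_left rep_closed)
  then show ?thesis
    using x
    by (auto simp: positive_functional_def hinner_rep_star_mult less_eq_complex_def)
qed

end

context cyclic_star_representation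
begin

text \<open>The restriction of \<open>\<pi>\<close> to \<open>orth H S\<close> has the cyclic vector
  \<open>p\<close>: projecting onto this invariant subspace turns \<open>\<pi> a \<xi>\<close> into
  \<open>\<pi> a p\<close> and does not increase the distance to a vector of the subspace.\<close>

lemma representable_component:
  assumes S: "S \<subseteq> carrier H" and inv: "\<And>a s. s \<in> S \<Longrightarrow> \<pi> a s \<in> S"
    and p: "p \<in> orth H S" and q: "q \<in> orth H (orth H S)" and \<xi>: "\<xi> = p \<oplus> q"
  shows "representable scl star (\<lambda>a. hinner H (\<pi> a p) p)"
proof -
  let ?K = "H\<lparr>carrier := orth H S\<rparr>"
  have pc: "p \<in> carrier H" and qc: "q \<in> carrier H"
    using p q by (auto simp: orth_def)
  interpret T: complex_hilbert_space ?K
    by (rule orth_hilbert_space[OF S])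
  interpret D: Metric_space "carrier H" "hdist H"
    by (rule hdist_metric)
  interpret E: Metric_space "orth H S" "hdist ?K"
    using T.hdist_metric by simp
  have sub: "x \<in> carrier H" if "x \<in> orth H S" for x
    using that orth_subset by blast
  have inv_orth: "\<pi> a x \<in> orth H S" if "x \<in> orth H S" for a x
    using rep_orth[OF S inv that] .
  have inv_orth_orth: "\<pi> a x \<in> orth H (orth H S)" if "x \<in> orth H (orth H S)" for a x
    using rep_orth[OF orth_subset inv_orth that] .
  have bounded: "\<exists>K. \<forall>x\<in>carrier ?K. hnorm ?K (\<pi> a x) \<le> K * hnorm ?K x" for a
  proof -
    obtain K where "\<forall>x\<in>carrier H. hnorm H (\<pi> a x) \<le> K * hnorm H x"
      using rep_bounded by blast
    then have "\<forall>x\<in>carrier ?K. hnorm ?K (\<pi> a x) \<le> K * hnorm ?K x"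
      using orth_subset by (auto simp: hnorm_def)
    then show ?thesis
      by blast
  qed
  have rep: "star_representation scl star ?K \<pi>"
    by (intro star_representation.intro star_representation_axioms.intro
        complex_star_algebra_axioms T.complex_hilbert_space_axioms bounded)
      (simp_all add: inv_orth sub rep_op_add rep_op_smult rep_add rep_scale rep_mult rep_star)
  have "y \<in> Abstract_Topology.closure_of E.mtopology (range (\<lambda>a. \<pi> a p))"
    if y: "y \<in> orth H S" for y
    unfolding E.metric_closure_of
  proof (safe intro!: y)
    fix d :: real assume "d > 0"
    have yc: "y \<in> carrier H"
      using y orth_subset by blast
    then have "y \<in> Abstract_Topology.closure_of D.mtopology (range (\<lambda>a. \<pi> a \<xi>))"
      using cyclic by simp
    then obtain a where "hdist H y (\<pi> a \<xi>) < d"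
      unfolding D.metric_closure_of using \<open>d > 0\<close> by auto
    then have a: "hnorm H (y \<ominus> \<pi> a \<xi>) < d"
      using yc by (simp add: hdist_def rep_closed cyclic_closed)
    \<comment> \<open>\<open>z\<close> is the component of \<open>y \<ominus> \<pi> a \<xi>\<close>
      in \<open>orth H S\<close>. The other component is, up to sign, \<open>\<pi> a q\<close>,
      which is orthogonal to \<open>z\<close>; hence \<open>z\<close> is no longer than the whole
      vector.\<close>
    define z where "z = y \<ominus> \<pi> a p"
    have z: "z \<in> orth H S" "z \<in> carrier H"
      using orth_add[OF S y orth_smult[OF S inv_orth[OF p], of "-1"]] orth_subset yc pc
      by (auto simp: z_def a_minus_def uminus_eq_smult rep_closed)
    have "hinner H (\<pi> a q) z = 0"
      using inv_orth_orth[OF q] z by (simp add: orth_def)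
    then have "hinner H z (\<pi> a q) = 0"
      using hinner_commute[of z "\<pi> a q"] z qc rep_closed by simp
    moreover have "y \<ominus> \<pi> a \<xi> = z \<ominus> \<pi> a q"
      using yc pc qc
      by (simp add: z_def \<xi> rep_op_add rep_closed a_minus_def M.minus_add M.a_assoc)
    ultimately have "Re (hinner H z z) \<le> Re (hinner H (y \<ominus> \<pi> a \<xi>) (y \<ominus> \<pi> a \<xi>))"
      using z qc hinner_nonneg[of "\<pi> a q"] \<open>hinner H (\<pi> a q) z = 0\<close>
      by (simp add: hinner_minus_left hinner_minus_right rep_closed less_eq_complex_def)
    then have "hnorm H z < d"
      using a by (smt (verit) hnorm_def real_sqrt_le_mono)
    then have "hdist H y (\<pi> a p) < d"
      using yc pc by (simp add: hdist_def z_def rep_closed)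
    then have "\<pi> a p \<in> E.mball y d"
      using y inv_orth[OF p] by (simp add: orth_hdist[OF S])
    then show "\<exists>y'\<in>range (\<lambda>a. \<pi> a p). y' \<in> E.mball y d"
      by blast
  qed
  moreover have "Abstract_Topology.closure_of E.mtopology (range (\<lambda>a. \<pi> a p)) \<subseteq> orth H S"
    unfolding E.metric_closure_of by blast
  ultimately have "Abstract_Topology.closure_of E.mtopology (range (\<lambda>a. \<pi> a p)) = orth H S"
    by blast
  then have "cyclic_star_representation scl star ?K \<pi> p"
    using rep p
    by (intro cyclic_star_representation.intro cyclic_star_representation_axioms.intro) auto
  then show ?thesis
    by (rule representableI[OF positive_functional_vector[OF pc]]) simp
qed

text \<open>The trivial splitting of \<xi> into \<zero> and \<xi> gives a representation of the zero
  functional, which has to belong to the set in the definition of \<open>singular\<close>.\<close>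

lemma representable_zero: "representable scl star (\<lambda>_. 0)"
proof -
  have "representable scl star (\<lambda>a. hinner H (\<pi> a \<zero>) \<zero>)"
    using cyclic_closed orth_orth_superset[of "carrier H"]
    by (intro representable_component[of "carrier H" \<zero> \<xi>]) (auto simp: rep_closed orth_zero)
  then show ?thesis
    by (simp add: hinner_zero_right rep_closed)
qed

end

text \<open>\<open>N a\<close> is the norm of \<open>\<pi> a \<xi>\<close>. With these properties
  \<open>g\<close> and the competitors \<open>h\<close> can be handled without their Hilbert spaces.
  The last one is not immediate without a unit: if all \<open>\<pi> a \<xi>\<close> vanish, so does
  every \<open>h a = hinner H (\<pi> a \<xi>) \<xi>\<close>.\<close>

lemma representable_seminorm:
  assumes "representable scl star h"
  obtains N :: "'a::ring \<Rightarrow> real" where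
    "\<And>a. h (star a * a) = of_real ((N a)\<^sup>2)" "\<And>a. 0 \<le> N a"
    "\<And>a b. N a \<le> N (a - b) + N b" "\<And>a b. N (a + b) \<le> N a + N b"
    "\<And>c a. N (scl c a) = cmod c * N a"
    "\<And>a b. N a = 0 \<Longrightarrow> N (b * a) = 0" "(\<And>a. N a = 0) \<Longrightarrow> h = (\<lambda>_. 0)"
proof -
  obtain H :: "(nat \<Rightarrow> 'a) inner_space" and \<pi> \<xi> where
    rep: "cyclic_star_representation scl star H \<pi> \<xi>" and h: "\<And>a. h a = hinner H (\<pi> a \<xi>) \<xi>"
    using assms unfolding representable_def by blast
  interpret cyclic_star_representation scl star H \<pi> \<xi>
    by (rule rep)
  have c[simp]: "\<pi> a \<xi> \<in> carrier H" for a
    by (simp add: rep_closed cyclic_closed)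
  have add: "hnorm H (\<pi> (a + b) \<xi>) \<le> hnorm H (\<pi> a \<xi>) + hnorm H (\<pi> b \<xi>)" for a b
    by (simp add: rep_add cyclic_closed hnorm_triangle)
  have scale: "hnorm H (\<pi> (scl c a) \<xi>) = cmod c * hnorm H (\<pi> a \<xi>)" for c a
  proof -
    have "hinner H (\<pi> (scl c a) \<xi>) (\<pi> (scl c a) \<xi>) = (c * cnj c) * hinner H (\<pi> a \<xi>) (\<pi> a \<xi>)"
      by (simp add: rep_scale cyclic_closed hinner_smult_left hinner_smult_right smult_in)
    then have "Re (hinner H (\<pi> (scl c a) \<xi>) (\<pi> (scl c a) \<xi>))
        = (cmod c)\<^sup>2 * Re (hinner H (\<pi> a \<xi>) (\<pi> a \<xi>))"
      by (simp add: complex_norm_square[symmetric])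
    then show ?thesis
      by (simp add: hnorm_def real_sqrt_mult)
  qed
  show thesis
  proof (rule that[of "\<lambda>a. hnorm H (\<pi> a \<xi>)"])
    show "h (star a * a) = of_real ((hnorm H (\<pi> a \<xi>))\<^sup>2)" for a
      by (simp add: h hinner_rep_star_mult cyclic_closed)
    show "hnorm H (\<pi> a \<xi>) \<le> hnorm H (\<pi> (a - b) \<xi>) + hnorm H (\<pi> b \<xi>)" for a b
      using add[of "a - b" b] by simp
    show "hnorm H (\<pi> (b * a) \<xi>) = 0" if "hnorm H (\<pi> a \<xi>) = 0" for a b
    proof -
      have "\<pi> b \<zero>\<^bsub>H\<^esub> = \<zero>\<^bsub>H\<^esub>"
        using rep_op_smult[of "\<zero>\<^bsub>H\<^esub>" b 0] smult_l_null rep_closed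
        by (simp add: zero_class)
      then show ?thesis
        using that by (simp add: hnorm_eq_0 rep_mult cyclic_closed)
    qed
    show "h = (\<lambda>_. 0)" if "\<And>a. hnorm H (\<pi> a \<xi>) = 0"
      using that by (intro ext) (simp add: h hnorm_eq_0 hinner_zero_left cyclic_closed)
  qed (simp_all add: add scale hnorm_nonneg)
qed

section \<open>The Lebesgue decomposition of \<open>f\<close> with respect to
  \<open>g\<close>\<close>

theorem theorem4p1:
  fixes scl :: "complex \<Rightarrow> 'a::ring \<Rightarrow> 'a" and star :: "'a \<Rightarrow> 'a"
    and f g :: "'a \<Rightarrow> complex"
  assumes "complex_star_algebra scl star"
    and "representable scl star f"
    and "representable scl star g"
  shows "\<exists>f_ac f_s.
    representable scl star f_ac \<and> representable scl star f_s \<and>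
    f = (\<lambda>a. f_ac a + f_s a) \<and>
    abs_continuous star f_ac g \<and>
    singular scl star f_s g \<and>
    functional_le star f_ac f \<and>
    (\<forall>h. representable scl star h \<and> functional_le star h f \<and> abs_continuous star h g
      \<longrightarrow> functional_le star h f_ac)"
proof -
  obtain H :: "(nat \<Rightarrow> 'a) inner_space" and \<pi> \<xi> where
    rep: "cyclic_star_representation scl star H \<pi> \<xi>" and f: "\<And>a. f a = hinner H (\<pi> a \<xi>) \<xi>"
    using assms(2) unfolding representable_def by blast
  interpret cyclic_star_representation scl star H \<pi> \<xi>
    by (rule rep)
  obtain G where G: "\<And>a. g (star a * a) = of_real ((G a)\<^sup>2)" "\<And>a. 0 \<le> G a"
    "\<And>a b. G (a + b) \<le> G a + G b" "\<And>c a. G (scl c a) = cmod c * G a"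
    "\<And>a b. G a = 0 \<Longrightarrow> G (b * a) = 0"
    using representable_seminorm[OF assms(3)] by metis
  define S where "S = {\<pi> k \<xi> | k. G k = 0}"
  have S: "S \<subseteq> carrier H"
    by (auto simp: S_def rep_closed cyclic_closed)
  have zero: "\<zero>\<^bsub>H\<^esub> \<in> S"
  proof -
    have "G 0 = 0" "\<pi> 0 \<xi> = \<zero>\<^bsub>H\<^esub>"
      using G(4)[of 0 0] rep_scale[of \<xi> 0 0] smult_l_null[of "\<pi> 0 \<xi>"]
      by (simp_all add: cyclic_closed rep_closed zero_class)
    then show ?thesis
      unfolding S_def by force
  qed
  have add: "s \<oplus>\<^bsub>H\<^esub> t \<in> S" if "s \<in> S" "t \<in> S" for s t
  proof -
    obtain k l where "s = \<pi> k \<xi>" "t = \<pi> l \<xi>" "G k = 0" "G l = 0"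
      using \<open>s \<in> S\<close> \<open>t \<in> S\<close> unfolding S_def by blast
    then have "s \<oplus>\<^bsub>H\<^esub> t = \<pi> (k + l) \<xi>" "G (k + l) = 0"
      using G(2)[of "k + l"] G(3)[of k l] by (simp_all add: rep_add cyclic_closed)
    then show ?thesis
      unfolding S_def by blast
  qed
  have smult: "c \<odot>\<^bsub>H\<^esub> s \<in> S" if "s \<in> S" for c s
  proof -
    obtain k where "s = \<pi> k \<xi>" "G k = 0"
      using \<open>s \<in> S\<close> unfolding S_def by blast
    then have "c \<odot>\<^bsub>H\<^esub> s = \<pi> (scl c k) \<xi>" "G (scl c k) = 0"
      by (simp_all add: rep_scale G(4) cyclic_closed)
    then show ?thesis
      unfolding S_def by blast
  qed
  have inv: "\<pi> a s \<in> S" if "s \<in> S" for a s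
  proof -
    obtain k where "s = \<pi> k \<xi>" "G k = 0"
      using \<open>s \<in> S\<close> unfolding S_def by blast
    then have "\<pi> a s = \<pi> (a * k) \<xi>" "G (a * k) = 0"
      by (simp_all add: rep_mult G(5) cyclic_closed)
    then show ?thesis
      unfolding S_def by blast
  qed
  obtain p q where p: "p \<in> orth H (orth H S)" and q: "q \<in> orth H S" and \<xi>: "\<xi> = p \<oplus>\<^bsub>H\<^esub> q"
    and approx: "\<And>\<epsilon>. \<epsilon> > 0 \<Longrightarrow> \<exists>s\<in>S. hnorm H (p \<ominus>\<^bsub>H\<^esub> s) < \<epsilon>"
    using orth_decomposition[OF S zero add smult cyclic_closed] by metis
  have pc[simp]: "p \<in> carrier H" and qc[simp]: "q \<in> carrier H"
    using p q by (auto simp: orth_def)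
  have [simp]: "\<pi> a p \<in> carrier H" "\<pi> a q \<in> carrier H" "\<pi> a \<xi> \<in> carrier H" for a
    by (simp_all add: rep_closed cyclic_closed)
  have inv_orth: "\<pi> a x \<in> orth H S" if "x \<in> orth H S" for a x
    using rep_orth[OF S inv that] .
  have orthogonal: "hinner H (\<pi> a p) y = 0" "hinner H y (\<pi> a p) = 0" if "y \<in> orth H S" for a y
  proof -
    show "hinner H (\<pi> a p) y = 0"
      using rep_orth[OF orth_subset inv_orth p] that by (simp add: orth_def)
    then show "hinner H y (\<pi> a p) = 0"
      using hinner_commute[of y "\<pi> a p"] that orth_subset by auto
  qed
  have \<pi>\<xi>: "\<pi> a \<xi> = \<pi> a p \<oplus>\<^bsub>H\<^esub> \<pi> a q" for a
    by (simp add: \<xi> rep_op_add)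
  define f_ac where "f_ac = (\<lambda>a. hinner H (\<pi> a q) q)"
  define f_s where "f_s = (\<lambda>a. hinner H (\<pi> a p) p)"
  have f_ac: "f_ac (star a * a) = of_real ((hnorm H (\<pi> a q))\<^sup>2)" for a
    by (simp add: f_ac_def hinner_rep_star_mult)
  have f_s: "f_s (star a * a) = of_real ((hnorm H (\<pi> a p))\<^sup>2)" for a
    by (simp add: f_s_def hinner_rep_star_mult)
  have f': "f (star a * a) = of_real ((hnorm H (\<pi> a \<xi>))\<^sup>2)" for a
    by (simp add: f hinner_rep_star_mult cyclic_closed)
  have \<xi>': "\<xi> = q \<oplus>\<^bsub>H\<^esub> p"
    by (simp add: \<xi> M.a_comm)
  have rep_ac: "representable scl star f_ac"
    unfolding f_ac_def by (rule representable_component[OF S _ q p \<xi>']) (rule inv)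
  \<comment> \<open>The singular part lives on the complement of \<open>orth H S\<close>, so
    \<open>representable_component\<close> is applied to \<open>orth H S\<close> in place of
    \<open>S\<close>, with \<open>p\<close> and \<open>q\<close> in exchanged roles.\<close>
  have "q \<in> orth H (orth H (orth H S))"
    using orth_orth_superset[OF orth_subset] q by blast
  then have rep_s: "representable scl star f_s"
    unfolding f_s_def
    by (intro representable_component[OF orth_subset _ p _ \<xi>]) (auto intro: inv_orth)
  have sum: "f = (\<lambda>a. f_ac a + f_s a)"
  proof
    fix a
    have "hinner H (\<pi> a q) p = 0"
      using p inv_orth[OF q] hinner_commute[of "\<pi> a q" p] by (simp add: orth_def)
    then have "hinner H (\<pi> a \<xi>) \<xi> = hinner H (\<pi> a q) q + hinner H (\<pi> a p) p"
      using orthogonal[OF q] by (subst (2) \<xi>) (simp add: \<pi>\<xi> hinner_add_left hinner_add_right)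
    then show "f a = f_ac a + f_s a"
      by (simp add: f f_ac_def f_s_def)
  qed
  \<comment> \<open>\<open>\<pi> k \<xi>\<close> lies in \<open>S\<close> and
    \<open>\<pi> k q\<close> in its complement. As \<open>\<pi> k p\<close> is orthogonal to
    \<open>\<pi> k q\<close> too, the latter is orthogonal to itself.\<close>
  have kernel: "\<pi> k q = \<zero>\<^bsub>H\<^esub>" if "G k = 0" for k
  proof -
    have "hinner H (\<pi> k q) (\<pi> k \<xi>) = 0"
      using inv_orth[OF q] that by (auto simp: orth_def S_def)
    then have "hinner H (\<pi> k q) (\<pi> k q) = 0"
      using orthogonal inv_orth[OF q] by (simp add: \<pi>\<xi> hinner_add_right)
    then show ?thesis
      using hinner_definite by simp
  qed
  have ac: "abs_continuous star f_ac g"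
    using kernel by (auto simp: abs_continuous_def G(1) f_ac hnorm_eq_0)
  \<comment> \<open>If \<open>\<pi> k \<xi>\<close> is close to \<open>p\<close>, then
    \<open>\<pi> (a * k) \<xi>\<close> is close to \<open>\<pi> a p\<close> by boundedness, and
    \<open>a * k\<close> stays in the left ideal where \<open>G\<close> vanishes.\<close>
  have approx': "\<exists>k. G k = 0 \<and> hnorm H (\<pi> a p \<ominus>\<^bsub>H\<^esub> \<pi> k \<xi>) \<le> \<epsilon>" if "\<epsilon> > 0" for a and \<epsilon> :: real
  proof -
    obtain K where K: "\<And>x. x \<in> carrier H \<Longrightarrow> hnorm H (\<pi> a x) \<le> K * hnorm H x"
      using rep_bounded[of a] by blast
    \<comment> \<open>The bound \<open>K\<close> may be 0 or negative, hence the denominator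
      \<open>\<bar>K\<bar> + 1\<close>.\<close>
    have pos: "0 < \<epsilon> / (\<bar>K\<bar> + 1)"
      using that by simp
    obtain k where k: "G k = 0" "hnorm H (p \<ominus>\<^bsub>H\<^esub> \<pi> k \<xi>) < \<epsilon> / (\<bar>K\<bar> + 1)"
      using approx[OF pos] unfolding S_def by blast
    have "\<pi> a p \<ominus>\<^bsub>H\<^esub> \<pi> (a * k) \<xi> = \<pi> a (p \<ominus>\<^bsub>H\<^esub> \<pi> k \<xi>)"
      by (simp add: a_minus_def uminus_eq_smult rep_op_add rep_op_smult smult_in rep_mult
          cyclic_closed rep_closed)
    then have "hnorm H (\<pi> a p \<ominus>\<^bsub>H\<^esub> \<pi> (a * k) \<xi>)
        = hnorm H (\<pi> a (p \<ominus>\<^bsub>H\<^esub> \<pi> k \<xi>))"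
      by simp
    also have "\<dots> \<le> K * hnorm H (p \<ominus>\<^bsub>H\<^esub> \<pi> k \<xi>)"
      by (simp add: K)
    also have "\<dots> \<le> (\<bar>K\<bar> + 1) * (\<epsilon> / (\<bar>K\<bar> + 1))"
      using k(2) by (intro mult_mono) (auto simp: hnorm_nonneg)
    also have "\<dots> = \<epsilon>"
      by simp
    finally show ?thesis
      using G(5)[OF k(1)] by blast
  qed
  have greatest: "functional_le star h f_ac"
    if h: "representable scl star h" "functional_le star h f" "abs_continuous star h g" for h
  proof -
    obtain N where N: "\<And>a. h (star a * a) = of_real ((N a)\<^sup>2)" "\<And>a. 0 \<le> N a"
      "\<And>a b. N a \<le> N (a - b) + N b"
      using representable_seminorm[OF h(1)] by metis
    have N_le: "N a \<le> hnorm H (\<pi> a \<xi>)" for a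
    proof (rule power2_le_imp_le)
      show "(N a)\<^sup>2 \<le> (hnorm H (\<pi> a \<xi>))\<^sup>2"
        using h(2) by (simp add: functional_le_def N(1) f' less_eq_complex_def)
    qed (simp add: hnorm_nonneg)
    have "N a \<le> hnorm H (\<pi> a q)" for a
    proof (rule field_le_epsilon)
      fix \<epsilon> :: real assume "\<epsilon> > 0"
      then obtain k where k: "G k = 0" "hnorm H (\<pi> a p \<ominus>\<^bsub>H\<^esub> \<pi> k \<xi>) \<le> \<epsilon>"
        using approx' by blast
      \<comment> \<open>Absolute continuity allows \<open>a\<close> to be replaced by
        \<open>a - k\<close>; the vector \<open>\<pi> (a - k) \<xi>\<close> is within \<epsilon> of
        \<open>\<pi> a q\<close>.\<close>
      have "N k = 0"
        using h(3) k(1) N(1)[of k] G(1)[of k] by (auto simp: abs_continuous_def)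
      then have "N a \<le> N (a - k)"
        using N(3)[of a k] by simp
      also have "\<dots> \<le> hnorm H (\<pi> (a - k) \<xi>)"
        by (rule N_le)
      also have "\<pi> (a - k) \<xi> = \<pi> a q \<oplus>\<^bsub>H\<^esub> (\<pi> a p \<ominus>\<^bsub>H\<^esub> \<pi> k \<xi>)"
        by (simp add: rep_minus cyclic_closed \<pi>\<xi>[of a] a_minus_def M.a_ac)
      also have "hnorm H \<dots> \<le> hnorm H (\<pi> a q) + hnorm H (\<pi> a p \<ominus>\<^bsub>H\<^esub> \<pi> k \<xi>)"
        by (simp add: hnorm_triangle)
      finally show "N a \<le> hnorm H (\<pi> a q) + \<epsilon>"
        using k(2) by simp
    qed
    then show ?thesis
      using N(2) by (simp add: functional_le_def N(1) f_ac less_eq_complex_def power_mono)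
  qed
  have "h = (\<lambda>_. 0)"
    if h: "representable scl star h" "dominated star h f_s" "dominated star h g" for h
  proof -
    obtain N where N: "\<And>a. h (star a * a) = of_real ((N a)\<^sup>2)" "\<And>a. 0 \<le> N a"
      "\<And>a b. N a \<le> N (a - b) + N b" "(\<And>a. N a = 0) \<Longrightarrow> h = (\<lambda>_. 0)"
      using representable_seminorm[OF h(1)] by metis
    obtain c where c: "0 \<le> c" "\<And>a. h (star a * a) \<le> of_real c * f_s (star a * a)"
      using h(2) unfolding dominated_def functional_le_def by blast
    obtain c' where c': "\<And>a. h (star a * a) \<le> of_real c' * g (star a * a)"
      using h(3) unfolding dominated_def functional_le_def by blast
    have N_le: "N a \<le> sqrt c * hnorm H (\<pi> a p)" for a
    proof (rule power2_le_imp_le)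
      show "(N a)\<^sup>2 \<le> (sqrt c * hnorm H (\<pi> a p))\<^sup>2"
        using c(1) c(2)[of a] by (simp add: N(1) f_s less_eq_complex_def power_mult_distrib)
    qed (simp add: c(1) hnorm_nonneg)
    have "N a \<le> 0" for a
    proof (rule le_zero_if_le_epsilon_mult)
      fix \<epsilon> :: real assume "\<epsilon> > 0"
      then obtain k where k: "G k = 0" "hnorm H (\<pi> a p \<ominus>\<^bsub>H\<^esub> \<pi> k \<xi>) \<le> \<epsilon>"
        using approx' by blast
      \<comment> \<open>Here domination by \<open>g\<close> makes \<open>N\<close> vanish at
        \<open>k\<close>. Since \<open>\<pi> k q\<close> is zero, \<open>\<pi> k p\<close> equals
        \<open>\<pi> k \<xi>\<close>, so \<open>\<pi> (a - k) p\<close> has norm at most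
        \<epsilon>.\<close>
      have "N k = 0"
        using c'[of k] k(1) by (simp add: N(1) G(1) less_eq_complex_def)
      then have "N a \<le> N (a - k)"
        using N(3)[of a k] by simp
      also have "\<dots> \<le> sqrt c * hnorm H (\<pi> (a - k) p)"
        by (rule N_le)
      also have "\<pi> (a - k) p = \<pi> a p \<ominus>\<^bsub>H\<^esub> \<pi> k \<xi>"
        using kernel[OF k(1)] by (simp add: rep_minus \<pi>\<xi>)
      also have "sqrt c * hnorm H \<dots> \<le> \<epsilon> * sqrt c"
        using mult_right_mono[OF k(2), of "sqrt c"] c(1) by (simp add: ac_simps)
      finally show "N a \<le> \<epsilon> * sqrt c" .
    qed
    then show ?thesis
      using N(2,4) by (simp add: order_antisym)
  qed
  moreover have "dominated star (\<lambda>_. 0) u" for u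
    unfolding dominated_def functional_le_def by (rule exI[of _ 0]) simp
  ultimately have "singular scl star f_s g"
    unfolding singular_def using representable_zero by blast
  moreover have "functional_le star f_ac f"
    unfolding functional_le_def by (subst sum) (simp add: f_s less_eq_complex_def)
  ultimately show ?thesis
    using rep_ac rep_s sum ac greatest by blast
qed

end
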